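(* The integrality gap of the linear programming relaxation defining $Z^{LP}_{\mathrm{inner}}(\pi)$ is exactly $4/3$; that is, $$\sup\ \frac{Z^{LP}_{\mathrm{inner}}(\pi)}{Z^{ILP}_{\mathrm{inner}}(\pi)}=\frac43,$$ where the supremum is over all instances $(G,w,\mathcal M_l,\mathcal M_f)$ and all $\pi\in\Delta(\mathcal I_l)$ with $Z^{ILP}_{\mathrm{inner}}(\pi)>0$.
   Context: Instance: a finite undirected graph $G=(V,E)$ with $V=\{1,\dots,n\}$ (each edge joins two distinct vertices; an edge is written $e=(u,v)$), edge weights $w_e\ge 0$, and two matroids $\mathcal M_l=(V,\mathcal I_l)$ and $\mathcal M_f=(V,\mathcal I_f)$. $\mathcal P_f\subseteq[0,1]^n$ is the matroid polytope of $\mathcal M_f$, i.e. the convex hull of incidence vectors of its independent sets. $\Delta(\mathcal I_l)$ is the set of probability distributions on $\mathcal I_l$. For $\pi\in\Delta(\mathcal I_l)$ let $q_v=\sum_{S\in\mathcal I_l:\,v\in S}\pi(S)$ for $v\in V$ and $q_{uv}=\sum_{S\in\mathcal I_l:\,u,v\in S}\pi(S)$ for $e=(u,v)\in E$, and set $w_e^u=w_e(1-q_u)$, $w_e^v=w_e(1-q_v)$, $w_e^{uv}=w_e(1-q_{uv})$. $Z^{ILP}_{\mathrm{inner}}(\pi)$ is the optimal value of the integer program $$\max\ \sum_{e=(u,v)\in E}\left[x_uw_e^u+x_vw_e^v+z_e(w_e^{uv}-w_e^u-w_e^v)\right]$$ subject to $x\in\mathcal P_f$; $z_e\ge x_u+x_v-1$,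 $z_e\le x_u$, $z_e\le x_v$ for all $e=(u,v)\in E$; $x_v\in\{0,1\}$ for all $v\in V$ and $z_e\in\{0,1\}$ for all $e\in E$. $Z^{LP}_{\mathrm{inner}}(\pi)$ is the optimal value of the linear program with the same objective subject to $x\in\mathcal P_f$, $z_e\ge x_u+x_v-1$ for all $e=(u,v)\in E$, and $0\le z_e\le1$ for all $e\in E$. *)

theory Defs
  imports "HOL-Probability.Probability" "HOL-Library.Function_Algebras"
begin

(* The number n of vertices varies inside the supremum, so vectors indexed by {1..n} are
   functions of type nat => real, with the pointwise vector space structure. *)

instantiation "fun" :: (type, real_vector) real_vector
begin

definition scaleR_fun :: "real \<Rightarrow> ('a \<Rightarrow> 'b) \<Rightarrow> 'a \<Rightarrow> 'b" where
  "scaleR_fun r f = (\<lambda>x. r *\<^sub>R f x)"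

instance
  by standard (auto simp: scaleR_fun_def fun_eq_iff scaleR_add_right scaleR_add_left)

end

locale matroid =
  fixes V :: "'a set" and \<I> :: "'a set set"
  assumes finite_ground: "finite V"
    and indep_subset_ground: "S \<in> \<I> \<Longrightarrow> S \<subseteq> V"
    and indep_empty: "{} \<in> \<I>"
    and indep_subset: "T \<in> \<I> \<Longrightarrow> S \<subseteq> T \<Longrightarrow> S \<in> \<I>"
    and augmentation: "S \<in> \<I> \<Longrightarrow> T \<in> \<I> \<Longrightarrow> card S < card T \<Longrightarrow>
      \<exists>v\<in>T - S. insert v S \<in> \<I>"

definition matroid_polytope :: "'a set set \<Rightarrow> ('a \<Rightarrow> real) set" where
  "matroid_polytope \<I> = convex hull (indicator ` \<I>)"

(* An edge (u, v) is the two-element set {u, v}. *)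

locale interdiction_instance =
  leader: matroid "{1..n}" \<I>l + follower: matroid "{1..n}" \<I>f
  for n :: nat and \<I>l \<I>f :: "nat set set" +
  fixes E :: "nat set set" and w :: "nat set \<Rightarrow> real"
  assumes edges: "e \<in> E \<Longrightarrow> e \<subseteq> {1..n} \<and> card e = 2"
    and weight_nonneg: "e \<in> E \<Longrightarrow> 0 \<le> w e"

(* q_v and q_uv are the cases A = {v} and A = {u, v}. *)

definition cover_prob :: "nat set set \<Rightarrow> nat set pmf \<Rightarrow> nat set \<Rightarrow> real" where
  "cover_prob \<I>l \<pi> A = (\<Sum>S\<in>{S \<in> \<I>l. A \<subseteq> S}. pmf \<pi> S)"

(* For e = {u, v}, w_e^u and w_e^uv are the values at A = {u} and A = e. *)

definition residual_weight ::
    "nat set set \<Rightarrow> (nat set \<Rightarrow> real) \<Rightarrow> nat set pmf \<Rightarrow> nat set \<Rightarrow> nat set \<Rightarrow> real" where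
  "residual_weight \<I>l w \<pi> e A = w e * (1 - cover_prob \<I>l \<pi> A)"

definition inner_objective ::
    "nat set set \<Rightarrow> nat set set \<Rightarrow> (nat set \<Rightarrow> real) \<Rightarrow> nat set pmf \<Rightarrow>
     (nat \<Rightarrow> real) \<Rightarrow> (nat set \<Rightarrow> real) \<Rightarrow> real" where
  "inner_objective \<I>l E w \<pi> x z =
     (\<Sum>e\<in>E. (\<Sum>v\<in>e. x v * residual_weight \<I>l w \<pi> e {v})
        + z e * (residual_weight \<I>l w \<pi> e e - (\<Sum>v\<in>e. residual_weight \<I>l w \<pi> e {v})))"

definition ilp_feasible ::
    "nat \<Rightarrow> nat set set \<Rightarrow> nat set set \<Rightarrow> ((nat \<Rightarrow> real) \<times> (nat set \<Rightarrow> real)) set" where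
  "ilp_feasible n \<I>f E = {(x, z). x \<in> matroid_polytope \<I>f
     \<and> (\<forall>u v. {u, v} \<in> E \<longrightarrow>
          z {u, v} \<ge> x u + x v - 1 \<and> z {u, v} \<le> x u \<and> z {u, v} \<le> x v)
     \<and> (\<forall>v\<in>{1..n}. x v \<in> {0, 1}) \<and> (\<forall>e\<in>E. z e \<in> {0, 1})}"

definition lp_feasible ::
    "nat set set \<Rightarrow> nat set set \<Rightarrow> ((nat \<Rightarrow> real) \<times> (nat set \<Rightarrow> real)) set" where
  "lp_feasible \<I>f E = {(x, z). x \<in> matroid_polytope \<I>f
     \<and> (\<forall>u v. {u, v} \<in> E \<longrightarrow> z {u, v} \<ge> x u + x v - 1)
     \<and> (\<forall>e\<in>E. 0 \<le> z e \<and> z e \<le> 1)}"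

(* For every interdiction_instance both programs are feasible and bounded and attain their
   optimum, so the suprema below are maxima. *)

definition Z_ILP_inner ::
    "nat \<Rightarrow> nat set set \<Rightarrow> nat set set \<Rightarrow> nat set set \<Rightarrow> (nat set \<Rightarrow> real) \<Rightarrow> nat set pmf \<Rightarrow> real"
  where
  "Z_ILP_inner n \<I>l \<I>f E w \<pi> =
     (SUP (x, z)\<in>ilp_feasible n \<I>f E. inner_objective \<I>l E w \<pi> x z)"

definition Z_LP_inner ::
    "nat set set \<Rightarrow> nat set set \<Rightarrow> nat set set \<Rightarrow> (nat set \<Rightarrow> real) \<Rightarrow> nat set pmf \<Rightarrow> real" where
  "Z_LP_inner \<I>l \<I>f E w \<pi> =
     (SUP (x, z)\<in>lp_feasible \<I>f E. inner_objective \<I>l E w \<pi> x z)"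

end

theory Submission
  imports Defs
begin

text \<open>
  Write \<open>a\<close>, \<open>b\<close> for the two endpoint weights of an edge and \<open>d\<close> for the coefficient of \<open>- z\<close>
  in the objective. Since the events that the leader covers \<open>u\<close> and that he covers \<open>v\<close> satisfy
  inclusion-exclusion, \<open>0 \<le> d \<le> min a b\<close>. An edge therefore contributes \<open>x a + y b - z d\<close> to the
  programs, and at a 0/1 point the best \<open>z\<close> is the product \<open>x y\<close>. Let \<open>F\<close> be the objective with
  every \<open>z\<close> replaced by this product, at fractional points as well.

  The upper bound has two steps. Edge by edge, the linear programming objective is at most
  \<open>4/3\<close> times the contribution to \<open>F\<close> at the same point \<open>x\<close> (\<open>edge_relaxation_bound\<close>). And some
  independent set of the follower has \<open>F\<close>-value at least \<open>F x\<close> (\<open>swap_rounding\<close>): \<open>F\<close> is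
  monotone, so \<open>x\<close> may be raised to a convex combination of bases, and because \<open>d \<ge> 0\<close>, \<open>F\<close> is
  convex along every line in a direction \<open>e\<^sub>i - e\<^sub>j\<close>. Two bases of the combination are
  merged by repeated symmetric exchange: one element is swapped in one of the two bases, which moves
  the point along such a line, and convexity guarantees that one of the two possible swaps does not
  lower \<open>F\<close>.

  The bound is attained without a limit. Take the four-cycle \<open>1, 3, 2, 4\<close> with unit weights, a
  leader who covers nothing, and a follower who may take at most one vertex of \<open>{1, 2}\<close> and one of
  \<open>{3, 4}\<close>. Any legal choice covers at most three edges, while \<open>x = 1/2\<close>, \<open>z = 0\<close> is
  worth four.
\<close>

section \<open>Symmetric exchange of bases in a matroid\<close>

context matroid
begin

definition basis :: "'a set \<Rightarrow> bool" where
  "basis B \<longleftrightarrow> B \<in> \<I> \<and> (\<forall>S\<in>\<I>. card S \<le> card B)"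

lemma finite_indep: "S \<in> \<I> \<Longrightarrow> finite S"
  using indep_subset_ground finite_ground finite_subset by blast

lemma finite_indep_family: "finite \<I>"
  by (rule finite_subset[OF _ finite_Pow_iff[THEN iffD2, OF finite_ground]])
    (use indep_subset_ground in blast)

lemma extend_indep:
  assumes "S \<in> \<I>" "T \<in> \<I>" "card S \<le> card T"
  shows "\<exists>J\<in>\<I>. S \<subseteq> J \<and> J \<subseteq> S \<union> T \<and> card J = card T"
  using assms
proof (induction "card T - card S" arbitrary: S)
  case 0
  then show ?case by (intro bexI[of _ S]) auto
next
  case (Suc k)
  then have "card S < card T" by simp
  then obtain v where v: "v \<in> T - S" "insert v S \<in> \<I>"
    using augmentation Suc.prems by blast
  have c: "card (insert v S) = Suc (card S)"
    using v finite_indep[OF Suc.prems(1)] by simp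
  then have "k = card T - card (insert v S)" "card (insert v S) \<le> card T"
    using Suc.hyps(2) by linarith+
  then obtain J where "J \<in> \<I>" "insert v S \<subseteq> J" "J \<subseteq> insert v S \<union> T" "card J = card T"
    using Suc.hyps(1)[OF _ v(2) Suc.prems(2)] by blast
  then show ?case using v by blast
qed

lemma basis_exists: "\<exists>B. basis B"
proof -
  have "\<I> \<noteq> {}" using indep_empty by auto
  then have "Max (card ` \<I>) \<in> card ` \<I>"
    using finite_indep_family by (intro Max_in) auto
  then obtain B where "B \<in> \<I>" "card B = Max (card ` \<I>)" by auto
  then show ?thesis
    unfolding basis_def using finite_indep_family by auto
qed

lemma indep_subset_basis:
  assumes "S \<in> \<I>" shows "\<exists>B. basis B \<and> S \<subseteq> B"
proof -
  obtain B where "basis B" using basis_exists by auto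
  then show ?thesis using extend_indep[OF assms, of B] assms by (metis basis_def)
qed

text \<open>
  The element \<open>j\<close> is taken from the fundamental circuit of \<open>i\<close> in \<open>B2\<close>, all of whose elements can
  leave \<open>B2\<close> in favour of \<open>i\<close>. If no element of the circuit other than \<open>i\<close> could replace \<open>i\<close>
  in \<open>B1\<close>, the rest of the circuit would lie in the span of \<open>B1 - {i}\<close>, and hence so would \<open>i\<close>,
  contradicting the independence of \<open>B1\<close>.
\<close>

lemma symmetric_exchange:
  assumes B1: "basis B1" and B2: "basis B2" and i: "i \<in> B1 - B2"
  shows "\<exists>j\<in>B2 - B1. basis (insert j (B1 - {i})) \<and> basis (insert i (B2 - {j}))"
proof -
  \<comment> \<open>the fundamental circuit of \<open>i\<close> in \<open>B2\<close>, without \<open>i\<close> itself\<close>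
  define C where "C = {j \<in> B2. insert i (B2 - {j}) \<in> \<I>}"
  have I: "B1 \<in> \<I>" "B2 \<in> \<I>" using B1 B2 by (auto simp: basis_def)
  have card_eq: "card B1 = card B2"
    using B1 B2 by (simp add: basis_def le_antisym)
  have fin: "finite B1" "finite B2" using I finite_indep by auto
  have CI: "C \<in> \<I>" and CB: "C \<subseteq> B2" using I(2) indep_subset by (auto simp: C_def)
  have iCI: "insert i C \<notin> \<I>"
  proof
    assume asm: "insert i C \<in> \<I>"
    have "card (insert i C) \<le> card B2" using asm B2 by (auto simp: basis_def)
    then obtain J where J: "J \<in> \<I>" "insert i C \<subseteq> J" "J \<subseteq> insert i C \<union> B2" "card J = card B2"
      using extend_indep[OF asm I(2)] by blast
    have Jsub: "J \<subseteq> insert i B2" using J(3) CB by auto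
    have "\<not> B2 \<subseteq> J"
    proof
      assume "B2 \<subseteq> J"
      then have "J = B2" using J(4) finite_indep[OF J(1)] by (metis card_subset_eq)
      then show False using J(2) i by auto
    qed
    then obtain j where j: "j \<in> B2" "j \<notin> J" by auto
    have "J \<subseteq> insert i (B2 - {j})" using Jsub j by auto
    moreover have "card (insert i (B2 - {j})) = card J"
      using J(4) i j fin card_Suc_Diff1[of B2 j] by simp
    ultimately have "J = insert i (B2 - {j})"
      using fin by (intro card_subset_eq) auto
    then have "j \<in> C" using J(1) j by (simp add: C_def)
    then show False using J(2) j by auto
  qed
  have "\<exists>j\<in>C - (B1 - {i}). insert j (B1 - {i}) \<in> \<I>"
  proof (rule ccontr)
    assume none: "\<not> ?thesis"
    have B1i: "B1 - {i} \<in> \<I>" by (rule indep_subset[OF I(1)]) auto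
    \<comment> \<open>\<open>B1 - {i}\<close> has full rank in its union with \<open>C\<close>\<close>
    have noext: "card K \<le> card (B1 - {i})" if K: "K \<in> \<I>" "K \<subseteq> C \<union> (B1 - {i})" for K
    proof (rule ccontr)
      assume "\<not> ?thesis"
      then obtain v where "v \<in> K - (B1 - {i})" "insert v (B1 - {i}) \<in> \<I>"
        using augmentation[OF B1i K(1)] by auto
      then show False using none K(2) by blast
    qed
    obtain J where J: "J \<in> \<I>" "C \<subseteq> J" "J \<subseteq> C \<union> (B1 - {i})" "card J = card (B1 - {i})"
      using extend_indep[OF CI B1i noext[OF CI]] by auto
    \<comment> \<open>\<open>J\<close> spans \<open>C \<union> (B1 - {i})\<close>, so augmenting it from \<open>B1\<close> can only add \<open>i\<close>\<close>
    have "card J < card B1" using J(4) i fin by (metis DiffD1 card_Diff1_less)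
    then obtain v where v: "v \<in> B1 - J" "insert v J \<in> \<I>"
      using augmentation[OF J(1) I(1)] by auto
    show False
    proof (cases "v = i")
      case True
      then have "insert i C \<subseteq> insert v J" using J(2) by auto
      then have "insert i C \<in> \<I>" by (rule indep_subset[OF v(2)])
      then show False using iCI by simp
    next
      case False
      then have "insert v J \<subseteq> C \<union> (B1 - {i})" using v J(3) by auto
      then have "card (insert v J) \<le> card J" using noext v(2) J(4) by simp
      then show False using v finite_indep[OF J(1)] by simp
    qed
  qed
  then obtain j where j: "j \<in> C" "j \<notin> B1 - {i}" "insert j (B1 - {i}) \<in> \<I>" by auto
  have jB: "j \<in> B2 - B1" using j i CB by auto
  have "card (insert j (B1 - {i})) = card B1" "card (insert i (B2 - {j})) = card B2"
    using jB i fin card_Suc_Diff1[of B1 i] card_Suc_Diff1[of B2 j] by simp_all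
  then show ?thesis
    using j jB B1 B2 unfolding basis_def C_def by auto
qed

end

section \<open>Swap rounding\<close>

text \<open>
  The property of \<open>F\<close> behind pipage and swap rounding. Multilinear extensions of submodular
  set functions have it.
\<close>

definition exchange_convex :: "(('a \<Rightarrow> real) \<Rightarrow> real) \<Rightarrow> bool" where
  "exchange_convex F \<longleftrightarrow> (\<forall>x i j. i \<noteq> j \<longrightarrow>
     convex_on UNIV (\<lambda>t. F (x + t *\<^sub>R (indicator {i} - indicator {j}))))"

text \<open>
  The interval \<open>[- \<alpha>, \<beta>]\<close> contains \<open>0\<close>, and a convex function on it is largest at an endpoint.
\<close>

lemma exchange_convex_endpoint:
  assumes F: "exchange_convex F" and ij: "i \<noteq> j" and nn: "0 \<le> \<alpha>" "0 \<le> \<beta>"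
  shows "F x \<le> F (x + \<beta> *\<^sub>R (indicator {i} - indicator {j})) \<or>
         F x \<le> F (x + (- \<alpha>) *\<^sub>R (indicator {i} - indicator {j}))"
proof (cases "\<alpha> + \<beta> = 0")
  case True
  then have "\<beta> = 0" using nn by simp
  then show ?thesis by simp
next
  case False
  define g where "g t = F (x + t *\<^sub>R (indicator {i} - indicator {j}))" for t
  have conv: "convex_on UNIV g"
    using F ij unfolding exchange_convex_def g_def by blast
  define s where "s = \<alpha> / (\<alpha> + \<beta>)"
  have s: "0 \<le> s" "s \<le> 1" using nn False by (auto simp: s_def field_simps)
  have "(1 - s) * (- \<alpha>) + s * \<beta> = 0"
    using False by (simp add: s_def field_simps)
  then have "g 0 \<le> (1 - s) * g (- \<alpha>) + s * g \<beta>"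
    using convex_onD[OF conv s, of "- \<alpha>" \<beta>] by simp
  moreover have "(1 - s) * g (- \<alpha>) + s * g \<beta> \<le> max (g (- \<alpha>)) (g \<beta>)"
    by (rule convex_bound_le) (use s in auto)
  ultimately have "g 0 \<le> g \<beta> \<or> g 0 \<le> g (- \<alpha>)" by linarith
  then show ?thesis by (simp add: g_def)
qed

lemma indicator_exchange:
  assumes "i \<notin> B" "j \<in> B"
  shows "(indicator (insert i (B - {j})) :: 'a \<Rightarrow> real)
    = indicator B + (indicator {i} - indicator {j})"
  using assms by (auto simp: fun_eq_iff indicator_def)

context matroid
begin

text \<open>
  For the exchange pair \<open>i\<close>, \<open>j\<close>, moving by \<open>\<beta>\<close> along \<open>e\<^sub>i - e\<^sub>j\<close> swaps \<open>j\<close> for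
  \<open>i\<close> in \<open>B2\<close>, and moving by \<open>\<alpha>\<close> the opposite way swaps \<open>i\<close> for \<open>j\<close> in \<open>B1\<close>. One of the two
  does not decrease \<open>F\<close>, and each brings the two bases closer, until they coincide.
\<close>

lemma merge_two_bases:
  fixes F :: "('a \<Rightarrow> real) \<Rightarrow> real"
  assumes F: "exchange_convex F" and nn: "0 \<le> \<alpha>" "0 \<le> \<beta>"
    and "basis B1" "basis B2"
  shows "\<exists>B. basis B \<and>
    F (r + \<alpha> *\<^sub>R indicator B1 + \<beta> *\<^sub>R indicator B2) \<le> F (r + (\<alpha> + \<beta>) *\<^sub>R indicator B)"
  using assms(4,5)
proof (induction "card (B1 - B2)" arbitrary: B1 B2)
  case 0
  have fin: "finite B1" "finite B2" using 0 finite_indep by (auto simp: basis_def)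
  then have "B1 \<subseteq> B2" using 0 by simp
  moreover have "card B1 = card B2" using 0 by (simp add: basis_def le_antisym)
  ultimately have "B1 = B2" using fin card_subset_eq by metis
  then show ?case using 0 by (intro exI[of _ B1]) (simp add: scaleR_add_left add.assoc)
next
  case (Suc k)
  have fin: "finite B1" "finite B2" using Suc.prems finite_indep by (auto simp: basis_def)
  have "B1 - B2 \<noteq> {}" using Suc.hyps(2) by (metis card.empty nat.distinct(1))
  then obtain i where i: "i \<in> B1 - B2" by auto
  obtain j where j: "j \<in> B2 - B1" and bases: "basis (insert j (B1 - {i}))" "basis (insert i (B2 - {j}))"
    using symmetric_exchange[OF Suc.prems i] by auto
  let ?d = "indicator {i} - indicator {j} :: 'a \<Rightarrow> real"
  let ?x = "r + \<alpha> *\<^sub>R indicator B1 + \<beta> *\<^sub>R indicator B2"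
  have "i \<noteq> j" using i j by auto
  then consider "F ?x \<le> F (?x + \<beta> *\<^sub>R ?d)" | "F ?x \<le> F (?x + (- \<alpha>) *\<^sub>R ?d)"
    using exchange_convex_endpoint[OF F _ nn] by blast
  then show ?case
  proof cases
    case 1
    have eq: "?x + \<beta> *\<^sub>R ?d = r + \<alpha> *\<^sub>R indicator B1 + \<beta> *\<^sub>R indicator (insert i (B2 - {j}))"
      using i j by (simp add: indicator_exchange scaleR_add_right add.assoc)
    have "B1 - insert i (B2 - {j}) = (B1 - B2) - {i}" using i j by auto
    then have "card (B1 - insert i (B2 - {j})) = k" using i fin Suc.hyps(2) by simp
    then show ?thesis
      using Suc.hyps(1)[OF _ Suc.prems(1) bases(2)] 1 unfolding eq by (meson order_trans)
  next
    case 2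
    have "(indicator (insert j (B1 - {i})) :: 'a \<Rightarrow> real) = indicator B1 + (indicator {j} - indicator {i})"
      using i j by (intro indicator_exchange) auto
    then have eq: "?x + (- \<alpha>) *\<^sub>R ?d = r + \<alpha> *\<^sub>R indicator (insert j (B1 - {i})) + \<beta> *\<^sub>R indicator B2"
      by (simp only: fun_eq_iff plus_fun_apply fun_diff_def scaleR_fun_def) (simp add: algebra_simps)
    have "insert j (B1 - {i}) - B2 = (B1 - B2) - {i}" using i j by auto
    then have "card (insert j (B1 - {i}) - B2) = k" using i fin Suc.hyps(2) by simp
    then show ?thesis
      using Suc.hyps(1)[OF _ bases(1) Suc.prems(2)] 2 unfolding eq by (meson order_trans)
  qed
qed

text \<open>
  The offset \<open>r\<close> holds the part of the convex combination that is not being merged.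
\<close>

lemma merge_bases:
  fixes F :: "('a \<Rightarrow> real) \<Rightarrow> real"
  assumes F: "exchange_convex F" and "finite K"
    and "\<And>k. k \<in> K \<Longrightarrow> 0 \<le> \<beta> k" and "\<And>k. k \<in> K \<Longrightarrow> basis (B k)"
  shows "\<exists>A. basis A \<and>
    F (r + (\<Sum>k\<in>K. \<beta> k *\<^sub>R indicator (B k))) \<le> F (r + (\<Sum>k\<in>K. \<beta> k) *\<^sub>R indicator A)"
  using assms(2-)
proof (induction K arbitrary: r rule: finite_induct)
  case empty
  then show ?case using basis_exists by auto
next
  case (insert k K)
  have nn: "0 \<le> \<beta> k" "0 \<le> (\<Sum>k\<in>K. \<beta> k)" and Bk: "basis (B k)"
    using insert.prems by (auto intro: sum_nonneg)
  obtain A where A: "basis A"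
    "F ((r + \<beta> k *\<^sub>R indicator (B k)) + (\<Sum>k\<in>K. \<beta> k *\<^sub>R indicator (B k)))
      \<le> F ((r + \<beta> k *\<^sub>R indicator (B k)) + (\<Sum>k\<in>K. \<beta> k) *\<^sub>R indicator A)"
    using insert.IH[of "r + \<beta> k *\<^sub>R indicator (B k)"] insert.prems by blast
  obtain A' where "basis A'"
    "F (r + \<beta> k *\<^sub>R indicator (B k) + (\<Sum>k\<in>K. \<beta> k) *\<^sub>R indicator A)
      \<le> F (r + (\<beta> k + (\<Sum>k\<in>K. \<beta> k)) *\<^sub>R indicator A')"
    using merge_two_bases[OF F nn Bk A(1)] by blast
  then show ?case
    using A(2) unfolding sum.insert[OF insert.hyps(1,2)] add.assoc by (meson order_trans)
qed

lemma matroid_polytope_bounds: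
  assumes "x \<in> matroid_polytope \<I>"
  shows "0 \<le> x v" "x v \<le> 1"
proof -
  have "indicator ` \<I> \<subseteq> {x :: 'a \<Rightarrow> real. 0 \<le> x v \<and> x v \<le> 1}"
    by (auto simp: indicator_def)
  moreover have "convex {x :: 'a \<Rightarrow> real. 0 \<le> x v \<and> x v \<le> 1}"
    by (auto simp: convex_def scaleR_fun_def intro: convex_bound_le)
  ultimately have "matroid_polytope \<I> \<subseteq> {x. 0 \<le> x v \<and> x v \<le> 1}"
    unfolding matroid_polytope_def by (rule hull_minimal)
  then show "0 \<le> x v" "x v \<le> 1" using assms by auto
qed

text \<open>
  Only sets of equal size can be merged by exchanges. Monotonicity above \<open>x\<close> pays for extending
  the independent sets in a convex representation of \<open>x\<close> to bases.
\<close>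

lemma swap_rounding:
  fixes F :: "('a \<Rightarrow> real) \<Rightarrow> real"
  assumes F: "exchange_convex F" and x: "x \<in> matroid_polytope \<I>"
    and mono: "\<And>y. y \<in> matroid_polytope \<I> \<Longrightarrow> (\<And>v. x v \<le> y v) \<Longrightarrow> F x \<le> F y"
  shows "\<exists>A\<in>\<I>. F x \<le> F (indicator A)"
proof -
  have fin: "finite (indicator ` \<I> :: ('a \<Rightarrow> real) set)" using finite_indep_family by simp
  obtain \<mu> where \<mu>: "\<And>y. y \<in> indicator ` \<I> \<Longrightarrow> 0 \<le> \<mu> y" "sum \<mu> (indicator ` \<I>) = 1"
    and x_eq: "x = (\<Sum>y\<in>indicator ` \<I>. \<mu> y *\<^sub>R y)"
    using x unfolding matroid_polytope_def convex_hull_finite[OF fin] by auto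
  define \<beta> where "\<beta> S = \<mu> (indicator S)" for S
  have inj: "inj_on (indicator :: 'a set \<Rightarrow> 'a \<Rightarrow> real) \<I>"
    by (rule inj_onI) (metis indicator_eq_1_iff set_eqI)
  have \<beta>: "\<And>S. S \<in> \<I> \<Longrightarrow> 0 \<le> \<beta> S" "sum \<beta> \<I> = 1"
    and x_sum: "x = (\<Sum>S\<in>\<I>. \<beta> S *\<^sub>R indicator S)"
    using \<mu> x_eq by (auto simp: \<beta>_def sum.reindex[OF inj] o_def)
  obtain B where B: "\<And>S. S \<in> \<I> \<Longrightarrow> basis (B S) \<and> S \<subseteq> B S"
    using indep_subset_basis by metis
  define y where "y = (\<Sum>S\<in>\<I>. \<beta> S *\<^sub>R (indicator (B S) :: 'a \<Rightarrow> real))"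
  have "y \<in> matroid_polytope \<I>"
    unfolding y_def matroid_polytope_def
    using B \<beta> finite_indep_family
    by (intro convex_sum) (auto intro!: hull_inc simp: basis_def)
  moreover have "x v \<le> y v" for v
  proof -
    have eval: "(\<Sum>S\<in>K. f S) v = (\<Sum>S\<in>K. f S v)" for K :: "'a set set" and f :: "'a set \<Rightarrow> 'a \<Rightarrow> real"
      by (induction K rule: infinite_finite_induct) auto
    show ?thesis
      unfolding x_sum y_def eval scaleR_fun_def
      using B \<beta>(1) by (intro sum_mono) (auto simp: indicator_def intro!: mult_left_mono)
  qed
  ultimately have "F x \<le> F y" using mono by blast
  moreover obtain A where "basis A" "F (0 + y) \<le> F (0 + sum \<beta> \<I> *\<^sub>R indicator A)"
    using merge_bases[OF F finite_indep_family, of \<beta> B 0] B \<beta>(1) unfolding y_def by blast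
  ultimately show ?thesis using \<beta>(2) by (intro bexI[of _ A]) (auto simp: basis_def)
qed

end

section \<open>The gap is at most 4/3\<close>

lemma convex_on_quadratic:
  fixes p q r :: real
  assumes "0 \<le> r"
  shows "convex_on UNIV (\<lambda>t. p + q * t + r * t\<^sup>2)"
proof (rule convex_onI)
  fix s x y :: real
  assume "0 < s" "s < 1"
  then have "0 \<le> r * (s * (1 - s) * (x - y)\<^sup>2)" using assms by simp
  also have "\<dots> = (1 - s) * (p + q * x + r * x\<^sup>2) + s * (p + q * y + r * y\<^sup>2)
      - (p + q * ((1 - s) *\<^sub>R x + s *\<^sub>R y) + r * ((1 - s) *\<^sub>R x + s *\<^sub>R y)\<^sup>2)"
    by (simp add: power2_eq_square algebra_simps)
  finally show "p + q * ((1 - s) *\<^sub>R x + s *\<^sub>R y) + r * ((1 - s) *\<^sub>R x + s *\<^sub>R y)\<^sup>2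
      \<le> (1 - s) * (p + q * x + r * x\<^sup>2) + s * (p + q * y + r * y\<^sup>2)" by simp
qed auto

lemma convex_on_finite_sum:
  fixes f :: "'i \<Rightarrow> 'b::real_vector \<Rightarrow> real"
  assumes "convex S" "\<And>i. i \<in> A \<Longrightarrow> convex_on S (f i)"
  shows "convex_on S (\<lambda>x. \<Sum>i\<in>A. f i x)"
  using assms(2)
  by (induction A rule: infinite_finite_induct) (auto simp: convex_on_const assms(1))

text \<open>
  As \<open>d\<close> is at most \<open>a\<close> and \<open>b\<close>, it suffices that \<open>4xy \<le> x + y + 3z\<close>. With \<open>s = x + y\<close>, the left
  side is at most \<open>s\<^sup>2\<close>. For \<open>s \<le> 1\<close> this is at most \<open>s\<close>; for \<open>s > 1\<close> the constraint
  \<open>z \<ge> s - 1\<close> leaves \<open>s\<^sup>2 \<le> 4s - 3\<close>, that is \<open>(s - 1)(3 - s) \<ge> 0\<close>. The bound is tight at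
  \<open>x = y = 1/2\<close>, \<open>z = 0\<close>, \<open>a = b = d\<close>.
\<close>

lemma edge_relaxation_bound:
  fixes a b d x y z :: real
  assumes d: "0 \<le> d" "d \<le> a" "d \<le> b" and x: "0 \<le> x" "x \<le> 1" and y: "0 \<le> y" "y \<le> 1"
    and z: "0 \<le> z" "x + y - 1 \<le> z"
  shows "x * a + y * b - z * d \<le> 4 / 3 * (x * a + y * b - x * y * d)"
proof -
  have "0 \<le> (x - y)\<^sup>2" by simp
  then have "4 * (x * y) \<le> (x + y)\<^sup>2" by (simp add: power2_eq_square algebra_simps)
  also have "\<dots> \<le> x + y + 3 * z"
  proof (cases "x + y \<le> 1")
    case True
    then have "(x + y) * (x + y) \<le> 1 * (x + y)" using x y by (intro mult_right_mono) auto
    then show ?thesis using z by (simp add: power2_eq_square)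
  next
    case False
    then have "0 \<le> (x + y - 1) * (3 - (x + y))" using x y by (intro mult_nonneg_nonneg) auto
    then show ?thesis using z by (simp add: power2_eq_square algebra_simps)
  qed
  finally have "d * (4 * (x * y)) \<le> d * (x + y + 3 * z)" using d by (intro mult_left_mono)
  moreover have "x * d \<le> x * a" "y * d \<le> y * b" using d x y by (auto intro: mult_left_mono)
  ultimately show ?thesis by (simp add: algebra_simps)
qed

text \<open>
  The partial derivatives are \<open>a - y d\<close> and \<open>b - x d\<close>, both nonnegative on the unit square.
\<close>

lemma edge_value_mono:
  fixes a b d x y x' y' :: real
  assumes "0 \<le> d" "d \<le> a" "d \<le> b" "0 \<le> x" "x \<le> x'" "x' \<le> 1" "0 \<le> y" "y \<le> y'" "y' \<le> 1"
  shows "x * a + y * b - x * y * d \<le> x' * a + y' * b - x' * y' * d"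
proof -
  have "y * d \<le> 1 * d" "x' * d \<le> 1 * d" using assms by (intro mult_right_mono; simp)+
  then have "0 \<le> (x' - x) * (a - y * d)" "0 \<le> (y' - y) * (b - x' * d)"
    using assms by (auto intro!: mult_nonneg_nonneg)
  then show ?thesis by (simp add: algebra_simps)
qed

context interdiction_instance
begin

text \<open>
  The coefficient of \<open>- z e\<close> in the objective: the weight that is counted twice when the follower
  takes both endpoints. For an edge \<open>{u, v}\<close> it is \<open>w e\<close> times the probability that the leader
  covers neither endpoint, provided that \<open>\<pi>\<close> lives on \<open>\<I>l\<close>.
\<close>

definition overlap :: "nat set pmf \<Rightarrow> nat set \<Rightarrow> real" where
  "overlap \<pi> e = (\<Sum>v\<in>e. residual_weight \<I>l w \<pi> e {v}) - residual_weight \<I>l w \<pi> e e"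

definition multilinear_objective :: "nat set pmf \<Rightarrow> (nat \<Rightarrow> real) \<Rightarrow> real" where
  "multilinear_objective \<pi> x = inner_objective \<I>l E w \<pi> x (\<lambda>e. \<Prod>v\<in>e. x v)"

lemma inner_objective_overlap:
  "inner_objective \<I>l E w \<pi> x z =
    (\<Sum>e\<in>E. (\<Sum>v\<in>e. x v * residual_weight \<I>l w \<pi> e {v}) - z e * overlap \<pi> e)"
  unfolding inner_objective_def overlap_def by (intro sum.cong) (auto simp: algebra_simps)

lemma edge_endpoints:
  assumes "e \<in> E" obtains u v where "e = {u, v}" "u \<noteq> v"
  using edges[OF assms] by (auto simp: card_2_iff)

lemma cover_prob_mono: "A \<subseteq> B \<Longrightarrow> cover_prob \<I>l \<pi> B \<le> cover_prob \<I>l \<pi> A"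
  unfolding cover_prob_def using leader.finite_indep_family by (intro sum_mono2) auto

lemma cover_prob_union_bound:
  "cover_prob \<I>l \<pi> A + cover_prob \<I>l \<pi> B - cover_prob \<I>l \<pi> (A \<union> B) \<le> 1"
proof -
  let ?S = "\<lambda>A. {S \<in> \<I>l. A \<subseteq> S}"
  have fin: "finite (?S A)" for A using leader.finite_indep_family by simp
  have "sum (pmf \<pi>) (?S A \<union> ?S B) + sum (pmf \<pi>) (?S A \<inter> ?S B) = sum (pmf \<pi>) (?S A) + sum (pmf \<pi>) (?S B)"
    by (rule sum.union_inter[OF fin fin])
  moreover have "?S A \<inter> ?S B = ?S (A \<union> B)" by auto
  moreover have "sum (pmf \<pi>) (?S A \<union> ?S B) \<le> 1"
    unfolding measure_measure_pmf_finite[OF finite_UnI[OF fin fin], symmetric]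
    by (rule measure_pmf.prob_le_1)
  ultimately show ?thesis unfolding cover_prob_def by simp
qed

text \<open>
  These bounds carry the proof: nonnegativity yields convexity along exchanges, and the upper bounds
  yield monotonicity and the factor \<open>4/3\<close>.
\<close>

lemma overlap_bounds:
  assumes "{u, v} \<in> E" "u \<noteq> v"
  shows "0 \<le> overlap \<pi> {u, v}"
    and "overlap \<pi> {u, v} \<le> residual_weight \<I>l w \<pi> {u, v} {u}"
    and "overlap \<pi> {u, v} \<le> residual_weight \<I>l w \<pi> {u, v} {v}"
proof -
  let ?q = "cover_prob \<I>l \<pi>"
  have w: "0 \<le> w {u, v}" using weight_nonneg assms by blast
  have eq: "overlap \<pi> {u, v} = w {u, v} * (1 - (?q {u} + ?q {v} - ?q {u, v}))"
    using assms(2) unfolding overlap_def residual_weight_def by (simp add: algebra_simps)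
  have "?q {u} + ?q {v} - ?q {u, v} \<le> 1"
    using cover_prob_union_bound[of \<pi> "{u}" "{v}"] by (simp add: insert_commute)
  then show "0 \<le> overlap \<pi> {u, v}" unfolding eq using w by simp
  have "?q {u, v} \<le> ?q {u}" "?q {u, v} \<le> ?q {v}" by (intro cover_prob_mono; simp)+
  then show "overlap \<pi> {u, v} \<le> residual_weight \<I>l w \<pi> {u, v} {u}"
    and "overlap \<pi> {u, v} \<le> residual_weight \<I>l w \<pi> {u, v} {v}"
    unfolding eq residual_weight_def using w by (auto intro!: mult_left_mono)
qed

lemma multilinear_objective_mono:
  assumes "\<And>v. 0 \<le> x v" "\<And>v. x v \<le> y v" "\<And>v. y v \<le> 1"
  shows "multilinear_objective \<pi> x \<le> multilinear_objective \<pi> y"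
  unfolding multilinear_objective_def inner_objective_overlap
proof (rule sum_mono)
  fix e assume "e \<in> E"
  then obtain u v where uv: "e = {u, v}" "u \<noteq> v" by (rule edge_endpoints)
  then show "(\<Sum>v\<in>e. x v * residual_weight \<I>l w \<pi> e {v}) - (\<Prod>v\<in>e. x v) * overlap \<pi> e
      \<le> (\<Sum>v\<in>e. y v * residual_weight \<I>l w \<pi> e {v}) - (\<Prod>v\<in>e. y v) * overlap \<pi> e"
    using edge_value_mono[OF overlap_bounds[of u v \<pi>], of "x u" "y u" "x v" "y v"]
      \<open>e \<in> E\<close> assms by simp
qed

text \<open>
  Along \<open>e\<^sub>i - e\<^sub>j\<close> each edge contributes a quadratic polynomial in \<open>t\<close>, whose leading
  coefficient is minus the overlap times the product of the entries of the direction at the two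
  endpoints. That product is never positive, since the only nonzero entries are \<open>1\<close> and \<open>- 1\<close> at
  different vertices.
\<close>

lemma exchange_convex_multilinear_objective: "exchange_convex (multilinear_objective \<pi>)"
  unfolding exchange_convex_def multilinear_objective_def inner_objective_overlap
proof (intro allI impI convex_on_finite_sum)
  fix x :: "nat \<Rightarrow> real" and i j :: nat and e
  assume "i \<noteq> j" "e \<in> E"
  obtain u v where uv: "e = {u, v}" "u \<noteq> v" using \<open>e \<in> E\<close> by (rule edge_endpoints)
  let ?d = "indicator {i} - indicator {j} :: nat \<Rightarrow> real"
  let ?a = "residual_weight \<I>l w \<pi> e {u}" and ?b = "residual_weight \<I>l w \<pi> e {v}"
  have "?d u * ?d v \<le> 0" using uv(2) by (auto simp: indicator_def)
  then have "0 \<le> - overlap \<pi> e * (?d u * ?d v)"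
    using overlap_bounds(1) uv \<open>e \<in> E\<close> by (simp add: mult_nonneg_nonpos)
  then have "convex_on UNIV (\<lambda>t. (x u * ?a + x v * ?b - x u * x v * overlap \<pi> e)
      + (?d u * ?a + ?d v * ?b - (x u * ?d v + x v * ?d u) * overlap \<pi> e) * t
      + (- overlap \<pi> e * (?d u * ?d v)) * t\<^sup>2)"
    by (rule convex_on_quadratic)
  also have "(\<lambda>t. (x u * ?a + x v * ?b - x u * x v * overlap \<pi> e)
      + (?d u * ?a + ?d v * ?b - (x u * ?d v + x v * ?d u) * overlap \<pi> e) * t
      + (- overlap \<pi> e * (?d u * ?d v)) * t\<^sup>2) =
    (\<lambda>t. (\<Sum>v\<in>e. (x + t *\<^sub>R ?d) v * residual_weight \<I>l w \<pi> e {v})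
      - (\<Prod>v\<in>e. (x + t *\<^sub>R ?d) v) * overlap \<pi> e)"
    using uv by (auto simp: fun_eq_iff scaleR_fun_def power2_eq_square algebra_simps)
  finally show "convex_on UNIV (\<lambda>t. (\<Sum>v\<in>e. (x + t *\<^sub>R ?d) v * residual_weight \<I>l w \<pi> e {v})
      - (\<Prod>v\<in>e. (x + t *\<^sub>R ?d) v) * overlap \<pi> e)" .
qed simp

lemma lp_objective_le_multilinear:
  assumes "(x, z) \<in> lp_feasible \<I>f E"
  shows "inner_objective \<I>l E w \<pi> x z \<le> 4 / 3 * multilinear_objective \<pi> x"
  unfolding multilinear_objective_def inner_objective_overlap sum_distrib_left
proof (rule sum_mono)
  fix e assume "e \<in> E"
  then obtain u v where uv: "e = {u, v}" "u \<noteq> v" by (rule edge_endpoints)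
  have x: "x \<in> matroid_polytope \<I>f" and z: "0 \<le> z {u, v}" "x u + x v - 1 \<le> z {u, v}"
    using assms uv \<open>e \<in> E\<close> unfolding lp_feasible_def by auto
  show "(\<Sum>v\<in>e. x v * residual_weight \<I>l w \<pi> e {v}) - z e * overlap \<pi> e
      \<le> 4 / 3 * ((\<Sum>v\<in>e. x v * residual_weight \<I>l w \<pi> e {v}) - (\<Prod>v\<in>e. x v) * overlap \<pi> e)"
    using edge_relaxation_bound[OF overlap_bounds[of u v \<pi>]
        follower.matroid_polytope_bounds[OF x, of u] follower.matroid_polytope_bounds[OF x, of v] z]
      uv \<open>e \<in> E\<close> by simp
qed

lemma indicator_ilp_feasible:
  assumes "A \<in> \<I>f"
  shows "(indicator A, \<lambda>e. \<Prod>v\<in>e. indicator A v) \<in> ilp_feasible n \<I>f E"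
proof -
  have "(indicator A :: nat \<Rightarrow> real) \<in> matroid_polytope \<I>f"
    using assms unfolding matroid_polytope_def by (auto intro: hull_inc)
  moreover have "u \<noteq> v" if "{u, v} \<in> E" for u v using edges[OF that] by auto
  moreover have "(\<Prod>v\<in>e. indicator A v :: real) \<in> {0, 1}" if "e \<in> E" for e
    using that by (rule edge_endpoints) (auto simp: indicator_def)
  ultimately show ?thesis
    unfolding ilp_feasible_def by (auto simp: indicator_def)
qed

lemma ilp_feasible_subset_lp_feasible: "ilp_feasible n \<I>f E \<subseteq> lp_feasible \<I>f E"
  unfolding ilp_feasible_def lp_feasible_def by fastforce

text \<open>
  This gives the gap bound and, since there are finitely many independent sets, also that both
  programs are bounded, without which the suprema would carry no information.
\<close>

lemma lp_objective_le_independent_set: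
  assumes "(x, z) \<in> lp_feasible \<I>f E"
  shows "\<exists>A\<in>\<I>f. inner_objective \<I>l E w \<pi> x z \<le> 4 / 3 * multilinear_objective \<pi> (indicator A)"
proof -
  have x: "x \<in> matroid_polytope \<I>f" using assms by (auto simp: lp_feasible_def)
  obtain A where A: "A \<in> \<I>f" "multilinear_objective \<pi> x \<le> multilinear_objective \<pi> (indicator A)"
    by (rule bexE, rule follower.swap_rounding[OF exchange_convex_multilinear_objective x])
      (intro multilinear_objective_mono follower.matroid_polytope_bounds x; simp)
  show ?thesis
    by (rule bexI[OF _ A(1)]) (use A(2) lp_objective_le_multilinear[OF assms, of \<pi>] in linarith)
qed

lemma bdd_above_lp:
  "bdd_above ((\<lambda>(x, z). inner_objective \<I>l E w \<pi> x z) ` lp_feasible \<I>f E)"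
proof (rule bdd_aboveI2, clarify)
  fix x z assume "(x, z) \<in> lp_feasible \<I>f E"
  then obtain A where "A \<in> \<I>f"
    "inner_objective \<I>l E w \<pi> x z \<le> 4 / 3 * multilinear_objective \<pi> (indicator A)"
    using lp_objective_le_independent_set by blast
  moreover have "multilinear_objective \<pi> (indicator A)
      \<le> Max ((\<lambda>A. multilinear_objective \<pi> (indicator A)) ` \<I>f)"
    using follower.finite_indep_family \<open>A \<in> \<I>f\<close> by (intro Max_ge) auto
  ultimately show "inner_objective \<I>l E w \<pi> x z
      \<le> 4 / 3 * Max ((\<lambda>A. multilinear_objective \<pi> (indicator A)) ` \<I>f)" by linarith
qed

lemma bdd_above_ilp:
  "bdd_above ((\<lambda>(x, z). inner_objective \<I>l E w \<pi> x z) ` ilp_feasible n \<I>f E)"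
  by (rule bdd_above_mono[OF bdd_above_lp image_mono[OF ilp_feasible_subset_lp_feasible]])

lemma ilp_feasible_nonempty: "ilp_feasible n \<I>f E \<noteq> {}"
  using indicator_ilp_feasible[OF follower.indep_empty] by blast

lemma Z_LP_le_Z_ILP: "Z_LP_inner \<I>l \<I>f E w \<pi> \<le> 4 / 3 * Z_ILP_inner n \<I>l \<I>f E w \<pi>"
  unfolding Z_LP_inner_def
proof (rule cSUP_least, use ilp_feasible_nonempty ilp_feasible_subset_lp_feasible in blast, clarify)
  fix x z assume "(x, z) \<in> lp_feasible \<I>f E"
  then obtain A where A: "A \<in> \<I>f"
    "inner_objective \<I>l E w \<pi> x z \<le> 4 / 3 * multilinear_objective \<pi> (indicator A)"
    using lp_objective_le_independent_set by blast
  have "multilinear_objective \<pi> (indicator A) \<le> Z_ILP_inner n \<I>l \<I>f E w \<pi>"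
    unfolding Z_ILP_inner_def multilinear_objective_def
    using cSUP_upper[OF indicator_ilp_feasible[OF A(1)] bdd_above_ilp] by simp
  then show "inner_objective \<I>l E w \<pi> x z \<le> 4 / 3 * Z_ILP_inner n \<I>l \<I>f E w \<pi>"
    using A(2) by linarith
qed

end

section \<open>A four-cycle attains the gap\<close>

definition cycle_edges :: "nat set set" where
  "cycle_edges = {{1, 3}, {2, 3}, {2, 4}, {1, 4}}"

text \<open>
  The partition matroid whose blocks \<open>{1, 2}\<close> and \<open>{3, 4}\<close> are the two sides of the bipartite
  four-cycle.
\<close>

definition cycle_indep :: "nat set set" where
  "cycle_indep = {S. S \<subseteq> {1..4} \<and> \<not> {1, 2} \<subseteq> S \<and> \<not> {3, 4} \<subseteq> S}"

lemma atLeastAtMost_1_4: "{1..4} = {1, 2, 3, 4 :: nat}" by auto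

text \<open>
  For augmentation, a larger independent set meets one of the blocks in more elements than the
  smaller one; as it meets each block at most once, the smaller set misses that block.
\<close>

lemma cycle_instance: "interdiction_instance 4 {{}} cycle_indep cycle_edges (\<lambda>_. 1)"
proof (unfold_locales)
  fix S T assume S: "S \<in> cycle_indep" and T: "T \<in> cycle_indep" and less: "card S < card T"
  have cards: "card R = card (R \<inter> {1, 2}) + card (R \<inter> {3, 4})" if "R \<in> cycle_indep" for R
  proof -
    have "R = (R \<inter> {1, 2}) \<union> (R \<inter> {3, 4})"
      using that by (auto simp: cycle_indep_def atLeastAtMost_1_4)
    then have "card R = card ((R \<inter> {1, 2}) \<union> (R \<inter> {3, 4}))" by simp
    also have "\<dots> = card (R \<inter> {1, 2}) + card (R \<inter> {3, 4})" by (rule card_Un_disjoint) auto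
    finally show ?thesis .
  qed
  have "\<exists>P\<in>{{1, 2}, {3, 4}}. card (S \<inter> P) < card (T \<inter> P)"
    using less cards[OF S] cards[OF T] by force
  then obtain P where P: "P \<in> {{1, 2}, {3, 4 :: nat}}" "card (S \<inter> P) < card (T \<inter> P)" by blast
  have finP: "finite P" using P(1) by auto
  have "card (T \<inter> P) \<noteq> 2"
  proof
    assume "card (T \<inter> P) = 2"
    moreover have "card P = 2" using P(1) by auto
    ultimately have "T \<inter> P = P" using finP by (metis card_subset_eq inf_le2)
    then show False using T P(1) by (auto simp: cycle_indep_def)
  qed
  moreover have "card (T \<inter> P) \<le> 2" using card_mono[OF finP, of "T \<inter> P"] P(1) by auto
  ultimately have "card (S \<inter> P) = 0" using P(2) by linarith
  then have "S \<inter> P = {}" using finP by simp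
  moreover have "T \<inter> P \<noteq> {}" using P(2) by (metis card.empty not_less_zero)
  then obtain v where "v \<in> T \<inter> P" by blast
  ultimately show "\<exists>v\<in>T - S. insert v S \<in> cycle_indep"
    using S T P(1) by (intro bexI[of _ v]) (auto simp: cycle_indep_def)
qed (auto simp: cycle_indep_def cycle_edges_def)

lemma cycle_objective:
  "inner_objective {{}} cycle_edges (\<lambda>_. 1) (return_pmf {}) x z =
    2 * (x 1 + x 2 + x 3 + x 4) - (z {1, 3} + z {2, 3} + z {2, 4} + z {1, 4})"
proof -
  have "{S \<in> {{}}. A \<subseteq> S} = {}" if "A \<noteq> {}" for A :: "nat set" using that by auto
  then have "residual_weight {{}} (\<lambda>_. 1) (return_pmf {}) e A = 1" if "A \<noteq> {}" for e A
    using that unfolding residual_weight_def cover_prob_def by simp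
  moreover have "{1, 3} \<noteq> {2, 3 :: nat}" "{1, 3} \<noteq> {2, 4 :: nat}" "{1, 3} \<noteq> {1, 4 :: nat}"
    "{2, 3} \<noteq> {2, 4 :: nat}" "{2, 3} \<noteq> {1, 4 :: nat}" "{2, 4} \<noteq> {1, 4 :: nat}"
    by (auto simp: doubleton_eq_iff)
  ultimately show ?thesis
    unfolding inner_objective_def cycle_edges_def by (simp add: algebra_simps)
qed

text \<open>
  The point is the midpoint of the incidence vectors of the two opposite independent sets
  \<open>{1, 3}\<close> and \<open>{2, 4}\<close>.
\<close>

lemma cycle_polytope_half: "(\<lambda>v. if v \<in> {1..4} then 1 / 2 else 0) \<in> matroid_polytope cycle_indep"
proof -
  have "(1 / 2) *\<^sub>R indicator {1, 3} + (1 / 2) *\<^sub>R (indicator {2, 4} :: nat \<Rightarrow> real) \<in> matroid_polytope cycle_indep"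
    unfolding matroid_polytope_def
    by (rule convexD[OF convex_convex_hull]) (auto intro!: hull_inc imageI simp: cycle_indep_def)
  also have "(1 / 2) *\<^sub>R indicator {1, 3} + (1 / 2) *\<^sub>R (indicator {2, 4} :: nat \<Rightarrow> real)
      = (\<lambda>v. if v \<in> {1..4} then 1 / 2 else 0)"
    by (auto simp: fun_eq_iff scaleR_fun_def indicator_def)
  finally show ?thesis .
qed

lemma cycle_polytope_bounds:
  assumes "x \<in> matroid_polytope cycle_indep"
  shows "x 1 + x 2 \<le> 1" "x 3 + x 4 \<le> 1"
proof -
  let ?H = "{x :: nat \<Rightarrow> real. x 1 + x 2 \<le> 1 \<and> x 3 + x 4 \<le> 1}"
  have "convex ?H"
  proof (rule convexI, clarify, intro conjI)
    fix x y :: "nat \<Rightarrow> real" and u v :: real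
    assume *: "x 1 + x 2 \<le> 1" "x 3 + x 4 \<le> 1" "y 1 + y 2 \<le> 1" "y 3 + y 4 \<le> 1"
      "0 \<le> u" "0 \<le> v" "u + v = 1"
    have "u * (x 1 + x 2) + v * (y 1 + y 2) \<le> 1" "u * (x 3 + x 4) + v * (y 3 + y 4) \<le> 1"
      using * by (auto intro: convex_bound_le)
    then show "(u *\<^sub>R x + v *\<^sub>R y) 1 + (u *\<^sub>R x + v *\<^sub>R y) 2 \<le> 1"
      "(u *\<^sub>R x + v *\<^sub>R y) 3 + (u *\<^sub>R x + v *\<^sub>R y) 4 \<le> 1"
      by (simp_all add: scaleR_fun_def algebra_simps)
  qed
  moreover have "indicator ` cycle_indep \<subseteq> ?H"
    by (auto simp: cycle_indep_def indicator_def)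
  ultimately have "matroid_polytope cycle_indep \<subseteq> ?H"
    unfolding matroid_polytope_def by (intro hull_minimal)
  then show "x 1 + x 2 \<le> 1" "x 3 + x 4 \<le> 1" using assms by auto
qed

lemma cycle_Z_LP: "4 \<le> Z_LP_inner {{}} cycle_indep cycle_edges (\<lambda>_. 1) (return_pmf {})"
proof -
  interpret interdiction_instance 4 "{{}}" cycle_indep cycle_edges "\<lambda>_. 1" by (rule cycle_instance)
  let ?x = "\<lambda>v :: nat. if v \<in> {1..4} then 1 / 2 else 0 :: real"
  have "(?x, \<lambda>_. 0) \<in> lp_feasible cycle_indep cycle_edges"
    using cycle_polytope_half unfolding lp_feasible_def by auto
  then have "inner_objective {{}} cycle_edges (\<lambda>_. 1) (return_pmf {}) ?x (\<lambda>_. 0)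
      \<le> Z_LP_inner {{}} cycle_indep cycle_edges (\<lambda>_. 1) (return_pmf {})"
    unfolding Z_LP_inner_def using cSUP_upper[OF _ bdd_above_lp] by fastforce
  then show ?thesis unfolding cycle_objective by simp
qed

text \<open>
  Every vertex has degree two, so one vertex gains two. Taking one vertex on each side
  gains four, but the two are adjacent and force \<open>z = 1\<close> on their common edge.
\<close>

lemma cycle_Z_ILP: "Z_ILP_inner 4 {{}} cycle_indep cycle_edges (\<lambda>_. 1) (return_pmf {}) \<le> 3"
proof -
  interpret interdiction_instance 4 "{{}}" cycle_indep cycle_edges "\<lambda>_. 1" by (rule cycle_instance)
  show ?thesis
    unfolding Z_ILP_inner_def
  proof (rule cSUP_least[OF ilp_feasible_nonempty], clarify)
    fix x z assume xz: "(x, z) \<in> ilp_feasible 4 cycle_indep cycle_edges"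
    have x: "x 1 + x 2 \<le> 1" "x 3 + x 4 \<le> 1"
      using xz cycle_polytope_bounds unfolding ilp_feasible_def by auto
    have int: "x v \<in> {0, 1}" if "v \<in> {1..4}" for v using xz that unfolding ilp_feasible_def by auto
    have ints: "x 1 \<in> {0, 1}" "x 2 \<in> {0, 1}" "x 3 \<in> {0, 1}" "x 4 \<in> {0, 1}"
      by (intro int; simp)+
    have e: "{1, 3} \<in> cycle_edges" "{2, 3} \<in> cycle_edges" "{2, 4} \<in> cycle_edges" "{1, 4} \<in> cycle_edges"
      by (auto simp: cycle_edges_def)
    have nn: "0 \<le> z e" if "e \<in> cycle_edges" for e
      using xz that unfolding ilp_feasible_def by fastforce
    have z: "x u + x v - 1 \<le> z {u, v}" if "{u, v} \<in> cycle_edges" for u v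
      using xz that unfolding ilp_feasible_def by auto
    show "inner_objective {{}} cycle_edges (\<lambda>_. 1) (return_pmf {}) x z \<le> 3"
      unfolding cycle_objective
      using x ints nn[OF e(1)] nn[OF e(2)] nn[OF e(3)] nn[OF e(4)]
        z[OF e(1)] z[OF e(2)] z[OF e(3)] z[OF e(4)]
      by (elim insertE emptyE) simp_all
  qed
qed

theorem corollary1:
  shows "Sup {ereal (Z_LP_inner \<I>l \<I>f E w \<pi> / Z_ILP_inner n \<I>l \<I>f E w \<pi>) | n \<I>l \<I>f E w \<pi>.
           interdiction_instance n \<I>l \<I>f E w \<and> set_pmf \<pi> \<subseteq> \<I>l
           \<and> Z_ILP_inner n \<I>l \<I>f E w \<pi> > 0} = ereal (4 / 3)"
    (is "Sup ?R = _")
proof (rule antisym)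
  show "Sup ?R \<le> ereal (4 / 3)"
  proof (rule Sup_least, clarify)
    fix n \<I>l \<I>f E w \<pi>
    assume "interdiction_instance n \<I>l \<I>f E w" and pos: "Z_ILP_inner n \<I>l \<I>f E w \<pi> > 0"
    then have "Z_LP_inner \<I>l \<I>f E w \<pi> \<le> 4 / 3 * Z_ILP_inner n \<I>l \<I>f E w \<pi>"
      by (intro interdiction_instance.Z_LP_le_Z_ILP)
    then show "ereal (Z_LP_inner \<I>l \<I>f E w \<pi> / Z_ILP_inner n \<I>l \<I>f E w \<pi>) \<le> ereal (4 / 3)"
      using pos by (simp add: divide_le_eq)
  qed
  define zl where "zl = Z_LP_inner {{}} cycle_indep cycle_edges (\<lambda>_. 1) (return_pmf {})"
  define zi where "zi = Z_ILP_inner 4 {{}} cycle_indep cycle_edges (\<lambda>_. 1) (return_pmf {})"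
  have zl: "4 \<le> zl" and zi: "zi \<le> 3" and zlzi: "zl \<le> 4 / 3 * zi"
    unfolding zl_def zi_def
    by (rule cycle_Z_LP cycle_Z_ILP interdiction_instance.Z_LP_le_Z_ILP[OF cycle_instance])+
  \<comment> \<open>the general bound applied to the cycle gives \<open>zi \<ge> 3\<close>\<close>
  then have pos: "zi > 0" by linarith
  have "4 / 3 * zi \<le> zl" using zl zi by linarith
  then have "ereal (4 / 3) \<le> ereal (zl / zi)" using pos by (simp add: le_divide_eq)
  also have "\<dots> \<le> Sup ?R"
    using cycle_instance pos unfolding zl_def zi_def
    by (intro Sup_upper CollectI exI conjI) (rule refl | assumption | simp)+
  finally show "ereal (4 / 3) \<le> Sup ?R" .
qed

end
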